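(* Let $A\in\mathbb{C}^{n\times n}$, $b_0,b_1,\dots,b_s\in\mathbb{C}^n$ with $b_s\neq 0$, let $X\in\mathbb{C}^{ns\times s}$ be any full-rank matrix whose columns form a basis of $\mathcal K_s(J,\overline b)$, let $W$, $Q_X$, $K_X$, $c_X$ be as defined in the context, and put $b=Q_Xc_X$. Define the first-block projection matrices $\Pi_{\rm K}=[I_n,0]\in\mathbb{C}^{n\times(n+s)}$ and $\Pi_{\rm W}=[I_n,0]\in\mathbb{C}^{n\times(n+ns)}$. Then $$\mathrm e^{W}b=Q_X\,\mathrm e^{K_X}c_X,\qquad \Pi_{\rm W}\,\mathrm e^{W}b=\Pi_{\rm K}\,\mathrm e^{K_X}c_X,$$ and, for any polynomial $p$, $$\Pi_{\rm K}\bigl(\mathrm e^{K_X}-p(K_X)\bigr)c_X=\Pi_{\rm W}\bigl(\mathrm e^{W}-p(W)\bigr)b .$$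
   Context: For a square matrix $M$ and a vector $v$, $\mathcal K_m(M,v)=\operatorname{span}\{v,Mv,\dots,M^{m-1}v\}$. Let $n,s\ge1$. $J_s(0)$ is the $s\times s$ Jordan block with eigenvalue zero (ones on the first superdiagonal, zeros elsewhere). Set $J=J_s(0)\otimes I_n\in\mathbb{C}^{ns\times ns}$ (Kronecker product), $E=[I_n,0,\dots,0]\in\mathbb{C}^{n\times ns}$, $$W=\begin{bmatrix}A&E\\0&J\end{bmatrix}\in\mathbb{C}^{(s+1)n\times(s+1)n},\qquad \overline b=[b_1^*,\dots,b_s^*]^*\in\mathbb{C}^{ns}.$$ Since $b_s\ne0$, $\dim\mathcal K_s(J,\overline b)=s$ and this space is $J$-invariant. For $X\in\mathbb{C}^{ns\times s}$ with columns forming a basis of $\mathcal K_s(J,\overline b)$, let $N\in\mathbb{C}^{s\times s}$ be the unique matrix with $JX=XN$ and let $\gamma\in\mathbb{C}^s$ be the unique vector with $\overline b=X\gamma$. Define $$K_X=\begin{bmatrix}A&EX\\0&N\end{bmatrix},\qquad c_X=\begin{bmatrix}b_0\\\gamma\end{bmatrix},\qquad Q_X=\begin{bmatrix}I_n&0\\0&X\end{bmatrix}.$$ Thus $Q_Xc_X=[b_0^*,\overline b^*]^*$. *)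

theory Defs
  imports Complex_Main "Jordan_Normal_Form.Jordan_Normal_Form" "Jordan_Normal_Form.DL_Rank"
begin

(* The type of matrices is not a topological algebra, so the exponential series is summed
   entry by entry; in finite dimension this is convergence in any norm.  The lemma
   mat_exp_entry_summable below shows that these series always converge. *)
definition mat_exp :: "complex mat \<Rightarrow> complex mat" where
  "mat_exp A = mat (dim_row A) (dim_row A)
     (\<lambda>(i, j). \<Sum>k. (A ^\<^sub>m k) $$ (i, j) / fact k)"

(* The matrix sum of coeff p k times A ^ k, written entrywise because matrices of all sizes
   share one type and so do not form a commutative monoid under addition. *)
definition mat_poly :: "complex poly \<Rightarrow> complex mat \<Rightarrow> complex mat" where
  "mat_poly p A = mat (dim_row A) (dim_row A)
     (\<lambda>(i, j). \<Sum>k\<le>degree p. coeff p k * (A ^\<^sub>m k) $$ (i, j))"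

definition kronecker :: "'a::times mat \<Rightarrow> 'a mat \<Rightarrow> 'a mat" where
  "kronecker A B = mat (dim_row A * dim_row B) (dim_col A * dim_col B)
     (\<lambda>(i, j). A $$ (i div dim_row B, j div dim_col B) * B $$ (i mod dim_row B, j mod dim_col B))"

definition krylov :: "nat \<Rightarrow> complex mat \<Rightarrow> complex vec \<Rightarrow> complex vec set" where
  "krylov m M v = LinearCombinations.module.span class_ring (module_vec TYPE(complex) (dim_vec v))
     ((\<lambda>j. (M ^\<^sub>m j) *\<^sub>v v) ` {..<m})"

(* The list of columns, without repetitions, is a basis of the subspace U of C^d,
   regarded as a vector space in its own right. *)
definition cols_form_basis :: "nat \<Rightarrow> complex mat \<Rightarrow> complex vec set \<Rightarrow> bool" where
  "cols_form_basis d X U \<longleftrightarrow> distinct (cols X) \<and>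
     vectorspace.basis class_ring ((module_vec TYPE(complex) d)\<lparr>carrier := U\<rparr>) (set (cols X))"

(* For m \<ge> n this is the n by m block matrix [I_n, 0]. *)
definition id_zero :: "nat \<Rightarrow> nat \<Rightarrow> complex mat" where
  "id_zero n m = mat n m (\<lambda>(i, j). if i = j then 1 else 0)"

definition J_mat :: "nat \<Rightarrow> nat \<Rightarrow> complex mat" where
  "J_mat n s = kronecker (jordan_block s 0) (1\<^sub>m n)"

definition E_mat :: "nat \<Rightarrow> nat \<Rightarrow> complex mat" where
  "E_mat n s = id_zero n (n * s)"

definition W_mat :: "nat \<Rightarrow> nat \<Rightarrow> complex mat \<Rightarrow> complex mat" where
  "W_mat n s A = four_block_mat A (E_mat n s) (0\<^sub>m (n * s) n) (J_mat n s)"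

(* The stacked vector of b 1, ..., b s; the vector b 0 is not part of it. *)
definition b_bar :: "nat \<Rightarrow> nat \<Rightarrow> (nat \<Rightarrow> complex vec) \<Rightarrow> complex vec" where
  "b_bar n s b = vec (n * s) (\<lambda>i. b (Suc (i div n)) $ (i mod n))"

definition N_mat :: "nat \<Rightarrow> nat \<Rightarrow> complex mat \<Rightarrow> complex mat" where
  "N_mat n s X = (THE N. N \<in> carrier_mat s s \<and> J_mat n s * X = X * N)"

definition gamma_vec :: "nat \<Rightarrow> nat \<Rightarrow> (nat \<Rightarrow> complex vec) \<Rightarrow> complex mat \<Rightarrow> complex vec" where
  "gamma_vec n s b X = (THE g. g \<in> carrier_vec s \<and> b_bar n s b = X *\<^sub>v g)"

definition K_mat :: "nat \<Rightarrow> nat \<Rightarrow> complex mat \<Rightarrow> complex mat \<Rightarrow> complex mat" where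
  "K_mat n s A X = four_block_mat A (E_mat n s * X) (0\<^sub>m s n) (N_mat n s X)"

definition c_vec :: "nat \<Rightarrow> nat \<Rightarrow> (nat \<Rightarrow> complex vec) \<Rightarrow> complex mat \<Rightarrow> complex vec" where
  "c_vec n s b X = b 0 @\<^sub>v gamma_vec n s b X"

definition Q_mat :: "nat \<Rightarrow> nat \<Rightarrow> complex mat \<Rightarrow> complex mat" where
  "Q_mat n s X = four_block_mat (1\<^sub>m n) (0\<^sub>m n s) (0\<^sub>m (n * s) n) X"

definition Pi_K :: "nat \<Rightarrow> nat \<Rightarrow> complex mat" where
  "Pi_K n s = id_zero n (n + s)"

definition Pi_W :: "nat \<Rightarrow> nat \<Rightarrow> complex mat" where
  "Pi_W n s = id_zero n (n + n * s)"

lemma mat_exp_entry_summable: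
  assumes A: "A \<in> carrier_mat n n" and ij: "i < n" "j < n"
  shows "summable (\<lambda>k. (A ^\<^sub>m k) $$ (i, j) / (fact k :: complex))"
proof -
  define c where "c = (\<Sum>i<n. \<Sum>j<n. norm (A $$ (i, j)))"
  have c: "norm (A $$ (l, j)) \<le> c" if "l < n" "j < n" for l j
  proof -
    have "norm (A $$ (l, j)) \<le> (\<Sum>j<n. norm (A $$ (l, j)))"
      by (rule member_le_sum) (use that in auto)
    also have "\<dots> \<le> c"
      unfolding c_def by (rule member_le_sum) (use that in \<open>auto intro: sum_nonneg\<close>)
    finally show ?thesis .
  qed
  have c0: "0 \<le> c" unfolding c_def by (intro sum_nonneg) auto
  have bound: "norm ((A ^\<^sub>m k) $$ (i, j)) \<le> (real n * c) ^ k" if "i < n" "j < n" for i j k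
    using that
  proof (induction k arbitrary: i j)
    case 0
    then show ?case using A by simp
  next
    case (Suc k)
    have P: "A ^\<^sub>m k \<in> carrier_mat n n" using A by simp
    have "norm ((A ^\<^sub>m Suc k) $$ (i, j)) = norm (\<Sum>l<n. (A ^\<^sub>m k) $$ (i, l) * A $$ (l, j))"
      using A P Suc.prems by (simp add: scalar_prod_def lessThan_atLeast0)
    also have "\<dots> \<le> (\<Sum>l<n. (real n * c) ^ k * c)"
      by (rule sum_norm_le)
        (use Suc c c0 in \<open>auto simp: norm_mult intro!: mult_mono\<close>)
    also have "\<dots> = (real n * c) ^ Suc k" by simp
    finally show ?case .
  qed
  show ?thesis
  proof (rule summable_comparison_test')
    show "summable (\<lambda>k. (real n * c) ^ k / fact k)"
      using summable_exp[of "real n * c"] by (simp add: field_simps)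
    show "norm ((A ^\<^sub>m k) $$ (i, j) / (fact k :: complex)) \<le> (real n * c) ^ k / fact k" for k
      using bound[OF ij, of k] by (simp add: norm_divide divide_right_mono)
  qed
qed

end

(* J is nilpotent of index s, so the Krylov space generated by b_bar is J-invariant and N exists;
   then W Q_X = Q_X K_X, and every power series in W intertwines with the same series in K_X. *)

theory Submission
  imports Defs
begin

text \<open>Write W, K, Q, c for \<open>W_mat\<close>, \<open>K_mat\<close>, \<open>Q_mat\<close>,
  \<open>c_vec\<close>. Everything follows from the intertwining relation W Q = Q K. By block
  multiplication both products have first block row [A, E X], and their second block rows are
  [0, J X] and [0, X N], so the relation is just J X = X N. It passes to powers, W^i Q = Q K^i,
  hence to polynomials and to the exponential series (\<open>mat_poly_intertwine\<close>,
  \<open>mat_exp_intertwine\<close>). Applying f(W) Q = Q f(K) to c gives the first identity. The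
  projected identities follow from it because [I, 0] Q = [I, 0]
  (\<open>id_zero_mult_four_block\<close>).

  It remains to see that N and gamma, which are definite descriptions, denote what they should. J is
  a block shift with J^s = 0, so applying J to the last Krylov vector J^(s-1) v gives 0 and the
  Krylov space is J-invariant (\<open>krylov_invariant\<close>). As the columns of X form a basis of
  that space, x -> X x is injective with the Krylov space as its range
  (\<open>cols_form_basisD\<close>). Invariance then gives existence of N and injectivity its
  uniqueness (\<open>intertwining_matrix_ex1\<close>). The same two facts about X give gamma, since
  v lies in its own Krylov space.\<close>

section \<open>Matrix functions and intertwining relations\<close>

lemma pow_mat_intertwine:
  assumes "M \<in> carrier_mat m m" "K \<in> carrier_mat k k" "Q \<in> carrier_mat m k"
    and "M * Q = Q * K"
  shows "M ^\<^sub>m i * Q = Q * K ^\<^sub>m i"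
proof (induction i)
  case 0
  then show ?case using assms by simp
next
  case (Suc i)
  have "M ^\<^sub>m Suc i * Q = M ^\<^sub>m i * (M * Q)"
    using assms by (simp add: assoc_mult_mat[of _ m m _ m _ k])
  also have "\<dots> = (M ^\<^sub>m i * Q) * K"
    using assms by (simp add: assoc_mult_mat[of _ m m _ k _ k])
  also have "\<dots> = Q * K ^\<^sub>m Suc i"
    using assms by (simp add: Suc assoc_mult_mat[of _ m k _ k _ k])
  finally show ?case .
qed

lemma index_mult_mat_sum:
  assumes "A \<in> carrier_mat m r" "B \<in> carrier_mat r k" "i < m" "j < k"
  shows "(A * B) $$ (i, j) = (\<Sum>l<r. A $$ (i, l) * B $$ (l, j))"
  using assms by (simp add: scalar_prod_def lessThan_atLeast0)

text \<open>Stated for entries because \<open>mat_exp\<close> and \<open>mat_poly\<close> are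
  defined by their entries.\<close>

lemma pow_mat_intertwine_index:
  assumes "M \<in> carrier_mat m m" "K \<in> carrier_mat k k" "Q \<in> carrier_mat m k"
    and "M * Q = Q * K" "a < m" "c < k"
  shows "(\<Sum>l<m. (M ^\<^sub>m i) $$ (a, l) * Q $$ (l, c)) = (\<Sum>l<k. Q $$ (a, l) * (K ^\<^sub>m i) $$ (l, c))"
proof -
  have "(M ^\<^sub>m i * Q) $$ (a, c) = (Q * K ^\<^sub>m i) $$ (a, c)"
    using pow_mat_intertwine[OF assms(1-4)] by simp
  then show ?thesis
    using assms index_mult_mat_sum[of "M ^\<^sub>m i" m m Q k a c]
      index_mult_mat_sum[of Q m k "K ^\<^sub>m i" k a c] by simp
qed

lemma mat_exp_carrier [simp]: "A \<in> carrier_mat n n \<Longrightarrow> mat_exp A \<in> carrier_mat n n"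
  by (simp add: mat_exp_def)

lemma mat_poly_carrier [simp]: "A \<in> carrier_mat n n \<Longrightarrow> mat_poly p A \<in> carrier_mat n n"
  by (simp add: mat_poly_def)

text \<open>Multiplication by \<open>Q\<close> is a finite sum in each entry, so it may be moved
  inside the entrywise series, where the relation for powers applies term by term, and out again on
  the other side. Summability of the single entries is all that the two interchanges
  require.\<close>

lemma mat_exp_intertwine:
  assumes M: "M \<in> carrier_mat m m" and K: "K \<in> carrier_mat k k" and Q: "Q \<in> carrier_mat m k"
    and eq: "M * Q = Q * K"
  shows "mat_exp M * Q = Q * mat_exp K"
proof (rule eq_matI)
  fix a c assume "a < dim_row (Q * mat_exp K)" "c < dim_col (Q * mat_exp K)"
  then have a: "a < m" and c: "c < k" using Q K by (auto simp: mat_exp_def)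
  have "(mat_exp M * Q) $$ (a, c) = (\<Sum>l<m. (\<Sum>i. (M ^\<^sub>m i) $$ (a, l) / fact i) * Q $$ (l, c))"
    using index_mult_mat_sum[of "mat_exp M" m m Q k a c] M Q a c by (simp add: mat_exp_def)
  also have "\<dots> = (\<Sum>l<m. \<Sum>i. (M ^\<^sub>m i) $$ (a, l) / fact i * Q $$ (l, c))"
    by (intro sum.cong refl suminf_mult2 mat_exp_entry_summable[OF M]) (use a in auto)
  also have "\<dots> = (\<Sum>i. \<Sum>l<m. (M ^\<^sub>m i) $$ (a, l) / fact i * Q $$ (l, c))"
    by (intro suminf_sum[symmetric] summable_mult2 mat_exp_entry_summable[OF M]) (use a in auto)
  also have "\<dots> = (\<Sum>i. \<Sum>l<k. Q $$ (a, l) * ((K ^\<^sub>m i) $$ (l, c) / fact i))"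
  proof (rule suminf_cong)
    fix i
    have "(\<Sum>l<m. (M ^\<^sub>m i) $$ (a, l) / fact i * Q $$ (l, c))
        = (\<Sum>l<m. (M ^\<^sub>m i) $$ (a, l) * Q $$ (l, c)) / fact i"
      by (simp add: sum_divide_distrib)
    also have "\<dots> = (\<Sum>l<k. Q $$ (a, l) * (K ^\<^sub>m i) $$ (l, c)) / fact i"
      by (simp only: pow_mat_intertwine_index[OF assms a c])
    finally show "(\<Sum>l<m. (M ^\<^sub>m i) $$ (a, l) / fact i * Q $$ (l, c))
        = (\<Sum>l<k. Q $$ (a, l) * ((K ^\<^sub>m i) $$ (l, c) / fact i))"
      by (simp add: sum_divide_distrib)
  qed
  also have "\<dots> = (\<Sum>l<k. \<Sum>i. Q $$ (a, l) * ((K ^\<^sub>m i) $$ (l, c) / fact i))"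
    by (intro suminf_sum summable_mult mat_exp_entry_summable[OF K]) (use c in auto)
  also have "\<dots> = (\<Sum>l<k. Q $$ (a, l) * (\<Sum>i. (K ^\<^sub>m i) $$ (l, c) / fact i))"
    by (intro sum.cong refl suminf_mult mat_exp_entry_summable[OF K]) (use c in auto)
  also have "\<dots> = (Q * mat_exp K) $$ (a, c)"
    using index_mult_mat_sum[of Q m k "mat_exp K" k a c] K Q a c by (simp add: mat_exp_def)
  finally show "(mat_exp M * Q) $$ (a, c) = (Q * mat_exp K) $$ (a, c)" .
qed (use M K Q in \<open>auto simp: mat_exp_def\<close>)

lemma mat_poly_intertwine:
  assumes M: "M \<in> carrier_mat m m" and K: "K \<in> carrier_mat k k" and Q: "Q \<in> carrier_mat m k"
    and eq: "M * Q = Q * K"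
  shows "mat_poly p M * Q = Q * mat_poly p K"
proof (rule eq_matI)
  fix a c assume "a < dim_row (Q * mat_poly p K)" "c < dim_col (Q * mat_poly p K)"
  then have a: "a < m" and c: "c < k" using Q K by (auto simp: mat_poly_def)
  have "(mat_poly p M * Q) $$ (a, c)
      = (\<Sum>l<m. (\<Sum>i\<le>degree p. coeff p i * (M ^\<^sub>m i) $$ (a, l)) * Q $$ (l, c))"
    using index_mult_mat_sum[of "mat_poly p M" m m Q k a c] M Q a c by (simp add: mat_poly_def)
  also have "\<dots> = (\<Sum>i\<le>degree p. coeff p i * (\<Sum>l<m. (M ^\<^sub>m i) $$ (a, l) * Q $$ (l, c)))"
    unfolding sum_distrib_right sum_distrib_left mult.assoc by (rule sum.swap)
  also have "\<dots> = (\<Sum>i\<le>degree p. coeff p i * (\<Sum>l<k. Q $$ (a, l) * (K ^\<^sub>m i) $$ (l, c)))"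
    by (simp only: pow_mat_intertwine_index[OF assms a c])
  also have "\<dots> = (\<Sum>l<k. Q $$ (a, l) * (\<Sum>i\<le>degree p. coeff p i * (K ^\<^sub>m i) $$ (l, c)))"
    unfolding sum_distrib_left by (subst sum.swap) (simp add: mult.left_commute)
  also have "\<dots> = (Q * mat_poly p K) $$ (a, c)"
    using index_mult_mat_sum[of Q m k "mat_poly p K" k a c] K Q a c by (simp add: mat_poly_def)
  finally show "(mat_poly p M * Q) $$ (a, c) = (Q * mat_poly p K) $$ (a, c)" .
qed (use M K Q in \<open>auto simp: mat_poly_def\<close>)

section \<open>The nilpotent block shift J\<close>

lemma J_mat_carrier [simp]: "J_mat n s \<in> carrier_mat (n * s) (n * s)"
  unfolding J_mat_def kronecker_def jordan_block_def by (rule carrier_matI) simp_all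

lemma dim_J_mat [simp]: "dim_row (J_mat n s) = n * s" "dim_col (J_mat n s) = n * s"
  by (rule carrier_matD[OF J_mat_carrier])+

text \<open>An index splits into a block number \<open>i div n\<close> and a position
  \<open>i mod n\<close> in the block. The Jordan block raises the former by one and the identity
  factor fixes the latter, which together is a shift of the index by \<open>n\<close>.\<close>

lemma J_mat_eq:
  "J_mat n s = mat (n * s) (n * s) (\<lambda>(i, j). if j = i + n then 1 else 0)" (is "_ = ?R")
proof (rule eq_matI)
  fix i j assume "i < dim_row ?R" "j < dim_col ?R"
  then have ij: "i < s * n" "j < s * n" by (simp_all add: mult.commute)
  then have n: "n > 0" by (cases n) auto
  have *: "j = i + n \<longleftrightarrow> j div n = Suc (i div n) \<and> i mod n = j mod n"
  proof
    assume "j = i + n"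
    then show "j div n = Suc (i div n) \<and> i mod n = j mod n" using n by simp
  next
    assume h: "j div n = Suc (i div n) \<and> i mod n = j mod n"
    have "j = j div n * n + j mod n" by simp
    also have "\<dots> = Suc (i div n) * n + i mod n" using h by simp
    also have "\<dots> = i + n" by simp
    finally show "j = i + n" .
  qed
  have "i div n < s" "j div n < s" using ij by (simp_all add: less_mult_imp_div_less)
  then have "J_mat n s $$ (i, j) = (if j div n = Suc (i div n) \<and> i mod n = j mod n then 1 else 0)"
    using ij n by (simp add: J_mat_def kronecker_def jordan_block_def)
  also have "\<dots> = ?R $$ (i, j)"
    using ij * by (simp add: mult.commute)
  finally show "J_mat n s $$ (i, j) = ?R $$ (i, j)" .
qed simp_all

lemma J_mat_pow:
  "J_mat n s ^\<^sub>m k = mat (n * s) (n * s) (\<lambda>(i, j). if j = i + k * n then 1 else 0)"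
proof (induction k)
  case 0
  then show ?case by (auto intro!: eq_matI)
next
  case (Suc k)
  have "(J_mat n s ^\<^sub>m k * J_mat n s) $$ (i, j) = (if j = i + Suc k * n then 1 else 0)"
    if ij: "i < n * s" "j < n * s" for i j
  proof -
    have J: "J_mat n s $$ (l, j) = (if j = l + n then 1 else 0)" if "l < n * s" for l
      using that ij by (simp add: J_mat_eq)
    have "(J_mat n s ^\<^sub>m k * J_mat n s) $$ (i, j)
        = (\<Sum>l<n * s. (J_mat n s ^\<^sub>m k) $$ (i, l) * J_mat n s $$ (l, j))"
      using ij by (intro index_mult_mat_sum) auto
    also have "\<dots> = (\<Sum>l<n * s. if l = i + k * n then (if j = i + Suc k * n then 1 else 0) else 0)"
      using ij by (intro sum.cong refl) (auto simp: Suc J)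
    \<comment> \<open>If \<open>i + k * n\<close> lies outside the index range, the sum has no
      nonzero term; the right-hand side is then 0 too, because \<open>j < n * s\<close>.\<close>
    also have "\<dots> = (if j = i + Suc k * n then 1 else 0)"
      using ij by (subst sum.delta) auto
    finally show ?thesis .
  qed
  then show ?case by (auto intro!: eq_matI)
qed

lemma J_mat_pow_eq_0: "J_mat n s ^\<^sub>m s = 0\<^sub>m (n * s) (n * s)"
  unfolding J_mat_pow by (auto intro!: eq_matI simp: mult.commute)

section \<open>Krylov spaces and their bases\<close>

lemma mult_mat_unit_vec:
  fixes A :: "'a :: semiring_1 mat"
  assumes "A \<in> carrier_mat n m" "j < m"
  shows "A *\<^sub>v unit_vec m j = col A j"
  using col_mult2[OF assms(1) one_carrier_mat assms(2)] assms by simp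

text \<open>Turns membership in the span into matrix algebra with the Krylov matrix. Its columns
  form a list, so the powers applied to \<open>v\<close> may repeat or be dependent.\<close>

lemma krylov_altdef:
  assumes M: "M \<in> carrier_mat d d" and v: "v \<in> carrier_vec d"
  shows "krylov m M v
    = (\<lambda>x. mat_of_cols d (map (\<lambda>j. (M ^\<^sub>m j) *\<^sub>v v) [0..<m]) *\<^sub>v x) ` carrier_vec m"
proof -
  interpret vec_space "TYPE(complex)" d .
  define Y where "Y = mat_of_cols d (map (\<lambda>j. (M ^\<^sub>m j) *\<^sub>v v) [0..<m])"
  have Y: "Y \<in> carrier_mat d m" by (rule carrier_matI) (simp_all add: Y_def)
  have "set (map (\<lambda>j. (M ^\<^sub>m j) *\<^sub>v v) [0..<m]) \<subseteq> carrier_vec d"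
    using M by (auto intro!: mult_mat_vec_carrier[of _ d d] v)
  then have "cols Y = map (\<lambda>j. (M ^\<^sub>m j) *\<^sub>v v) [0..<m]"
    unfolding Y_def by (rule cols_mat_of_cols)
  then have "set (cols Y) = (\<lambda>j. (M ^\<^sub>m j) *\<^sub>v v) ` {..<m}" by (simp add: lessThan_atLeast0)
  then have "krylov m M v = col_space Y"
    using v by (simp add: krylov_def col_space_def)
  also have "\<dots> = (\<lambda>x. Y *\<^sub>v x) ` carrier_vec m"
    unfolding col_space_eq[OF Y] using Y by (auto intro: mult_mat_vec_carrier)
  finally show ?thesis unfolding Y_def .
qed

text \<open>On the Krylov matrix \<open>Y\<close>, multiplication by \<open>M\<close> moves every
  column to the next one and sends the last to M^m v = 0. Thus M Y = Y S for a shift matrix S, and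
  the range of \<open>Y\<close> is invariant.\<close>

lemma krylov_invariant:
  assumes M: "M \<in> carrier_mat d d" and v: "v \<in> carrier_vec d"
    and nil: "M ^\<^sub>m m = 0\<^sub>m d d" and u: "u \<in> krylov m M v"
  shows "M *\<^sub>v u \<in> krylov m M v"
proof -
  define Y where "Y = mat_of_cols d (map (\<lambda>j. (M ^\<^sub>m j) *\<^sub>v v) [0..<m])"
  have Y: "Y \<in> carrier_mat d m" by (rule carrier_matI) (simp_all add: Y_def)
  have colY: "col Y j = (M ^\<^sub>m j) *\<^sub>v v" if "j < m" for j
    unfolding Y_def using that M v by (subst col_mat_of_cols) (auto intro!: mult_mat_vec_carrier[of _ d d])
  \<comment> \<open>The companion matrix of x^m: ones on the first subdiagonal and a zero last
    column.\<close>
  define S :: "complex mat" where "S = mat m m (\<lambda>(i, j). if i = Suc j then 1 else 0)"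
  have S: "S \<in> carrier_mat m m" by (simp add: S_def)
  have MY: "M * Y = Y * S"
  proof (rule mat_col_eqI)
    fix j assume "j < dim_col (Y * S)"
    then have j: "j < m" using S by simp
    have "col (M * Y) j = M *\<^sub>v ((M ^\<^sub>m j) *\<^sub>v v)"
      using j col_mult2[OF M Y] colY by simp
    also have "\<dots> = (M * M ^\<^sub>m j) *\<^sub>v v"
      using M v by (simp add: assoc_mult_mat_vec[of _ d d _ d])
    \<comment> \<open>\<open>pow_mat\<close> appends factors on the right; intertwining
      \<open>M\<close> with itself through \<open>M\<close> says that \<open>M\<close> commutes with
      its powers.\<close>
    also have "M * M ^\<^sub>m j = M ^\<^sub>m Suc j"
      using pow_mat_intertwine[OF M M M refl, of j] by simp
    finally have l: "col (M * Y) j = (M ^\<^sub>m Suc j) *\<^sub>v v" .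
    have r: "col (Y * S) j = Y *\<^sub>v col S j" using col_mult2[OF Y S j] .
    show "col (M * Y) j = col (Y * S) j"
    proof (cases "Suc j < m")
      case True
      then have "col S j = unit_vec m (Suc j)" using j by (auto simp: S_def)
      moreover have "Y *\<^sub>v unit_vec m (Suc j) = col Y (Suc j)"
        using mult_mat_unit_vec[OF Y True] by simp
      ultimately show ?thesis using l r colY[OF True] by simp
    next
      case False
      then have m: "Suc j = m" using j by simp
      have "col S j = 0\<^sub>v m" using j m by (auto simp: S_def)
      then show ?thesis using l r nil m Y v by (auto simp del: pow_mat.simps)
    qed
  qed (use M Y S in auto)
  from u obtain x where x: "x \<in> carrier_vec m" "u = Y *\<^sub>v x"
    unfolding krylov_altdef[OF M v] Y_def by auto
  have "M *\<^sub>v u = (Y * S) *\<^sub>v x"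
    using x M Y by (simp add: MY[symmetric] assoc_mult_mat_vec[of _ d d _ m])
  also have "\<dots> = Y *\<^sub>v (S *\<^sub>v x)"
    using x S Y by (simp add: assoc_mult_mat_vec[of _ d m _ m])
  finally show ?thesis
    unfolding krylov_altdef[OF M v] Y_def[symmetric] using S x by (auto intro!: mult_mat_vec_carrier)
qed

text \<open>Spanning gives the range and linear independence gives injectivity.\<close>

lemma cols_form_basisD:
  assumes X: "X \<in> carrier_mat d m" and M: "M \<in> carrier_mat d d" and v: "v \<in> carrier_vec d"
    and basis: "cols_form_basis d X (krylov k M v)"
  shows "krylov k M v = (\<lambda>x. X *\<^sub>v x) ` carrier_vec m"
    and "inj_on (\<lambda>x. X *\<^sub>v x) (carrier_vec m)"
proof -
  interpret vec_space "TYPE(complex)" d .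
  define G where "G = (\<lambda>j. (M ^\<^sub>m j) *\<^sub>v v) ` {..<k}"
  have G: "G \<subseteq> carrier_vec d"
    using M by (auto simp: G_def intro!: mult_mat_vec_carrier[of _ d d] v)
  let ?U = "krylov k M v"
  have U: "?U = span G" using v by (simp add: krylov_def G_def)
  have sub: "submodule class_ring ?U V" unfolding U by (rule span_is_submodule) (use G in simp)
  have vs: "vectorspace class_ring (V\<lparr>carrier := ?U\<rparr>)"
    using sub submodule_is_module class_field unfolding vectorspace_def by blast
  have b: "distinct (cols X)" "vectorspace.basis class_ring (V\<lparr>carrier := ?U\<rparr>) (set (cols X))"
    using basis unfolding cols_form_basis_def by auto
  note b' = b(2)[unfolded vectorspace.basis_def[OF vs]]
  have XU: "set (cols X) \<subseteq> ?U" using b' by simp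
  \<comment> \<open>The basis is one of the subspace as a space of its own; span and linear
    dependence computed there agree with those in the ambient space.\<close>
  note nd = span_li_not_depend[OF XU sub]
  have indpt: "\<not> lin_dep (set (cols X))" using b' nd by simp
  have "?U = col_space X" using b' nd by (simp add: col_space_def)
  also have "\<dots> = (\<lambda>x. X *\<^sub>v x) ` carrier_vec m"
    unfolding col_space_eq[OF X] using X by (auto intro: mult_mat_vec_carrier)
  finally show "?U = (\<lambda>x. X *\<^sub>v x) ` carrier_vec m" .
  show "inj_on (\<lambda>x. X *\<^sub>v x) (carrier_vec m)"
  proof (rule inj_onI)
    fix x y assume xy: "x \<in> carrier_vec m" "y \<in> carrier_vec m" "X *\<^sub>v x = X *\<^sub>v y"
    have "X *\<^sub>v (x - y) = 0\<^sub>v d"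
      using xy X by (simp add: mult_minus_distrib_mat_vec[OF X])
    \<comment> \<open>A nonzero kernel vector would be a dependency among the columns. Dependence is
      a notion for sets, so distinctness of the columns enters here to keep coefficients of equal
      columns from cancelling.\<close>
    then have "x - y = 0\<^sub>v m"
      using lin_depI[OF X _ _ _ b(1), of "x - y"] indpt xy by auto
    then have "(x - y) $ i = 0" if "i < m" for i using that by simp
    then show "x = y" using xy by (intro eq_vecI) auto
  qed
qed

text \<open>Column \<open>j\<close> of \<open>X\<close> is the image of a unit vector, so invariance
  of the range supplies column \<open>j\<close> of \<open>N\<close>; injectivity determines
  it.\<close>

lemma intertwining_matrix_ex1:
  fixes X M :: "'a :: semiring_1 mat"
  assumes X: "X \<in> carrier_mat d m" and M: "M \<in> carrier_mat d d"
    and inj: "inj_on (\<lambda>x. X *\<^sub>v x) (carrier_vec m)"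
    and inv: "\<And>x. x \<in> carrier_vec m \<Longrightarrow> M *\<^sub>v (X *\<^sub>v x) \<in> (\<lambda>x. X *\<^sub>v x) ` carrier_vec m"
  shows "\<exists>!N. N \<in> carrier_mat m m \<and> M * X = X * N"
proof -
  have "\<exists>y\<in>carrier_vec m. M *\<^sub>v col X j = X *\<^sub>v y" if "j < m" for j
    using inv[of "unit_vec m j"] mult_mat_unit_vec[OF X that] by auto
  then obtain f where f: "\<And>j. j < m \<Longrightarrow> f j \<in> carrier_vec m"
      "\<And>j. j < m \<Longrightarrow> M *\<^sub>v col X j = X *\<^sub>v f j"
    by metis
  define N where "N = mat_of_cols m (map f [0..<m])"
  have N: "N \<in> carrier_mat m m" by (rule carrier_matI) (simp_all add: N_def)
  have colN: "col N j = f j" if "j < m" for j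
    unfolding N_def using that f by (subst col_mat_of_cols) auto
  have "M * X = X * N"
  proof (rule mat_col_eqI)
    fix j assume "j < dim_col (X * N)"
    then have j: "j < m" using N by simp
    show "col (M * X) j = col (X * N) j"
      unfolding col_mult2[OF M X j] col_mult2[OF X N j] colN[OF j] by (rule f(2)[OF j])
  qed (use M X N in auto)
  moreover have "N' = N" if N': "N' \<in> carrier_mat m m" and "M * X = X * N'" for N'
  proof (rule mat_col_eqI)
    fix j assume "j < dim_col N"
    then have j: "j < m" using N by simp
    have "X *\<^sub>v col N' j = X *\<^sub>v col N j"
      using col_mult2[OF X N' j] col_mult2[OF X N j] \<open>M * X = X * N\<close> \<open>M * X = X * N'\<close> by simp
    then show "col N' j = col N j"
      using inj N N' j by (auto dest!: inj_onD)
  qed (use N N' in auto)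
  ultimately show ?thesis using N by blast
qed

section \<open>The block matrices and the final identities\<close>

lemma id_zero_mult_four_block:
  assumes "X \<in> carrier_mat m k"
  shows "id_zero n (n + m) * four_block_mat (1\<^sub>m n) (0\<^sub>m n k) (0\<^sub>m m n) X = id_zero n (n + k)"
proof -
  \<comment> \<open>Empty lower blocks make [I, 0] a four-block matrix, so that the block product
    rule applies.\<close>
  have id: "id_zero n (n + r) = four_block_mat (1\<^sub>m n) (0\<^sub>m n r) (0\<^sub>m 0 n) (0\<^sub>m 0 r)" for r
    by (rule eq_matI) (auto simp: id_zero_def)
  show ?thesis unfolding id
    by (subst mult_four_block_mat[OF one_carrier_mat zero_carrier_mat zero_carrier_mat
          zero_carrier_mat one_carrier_mat zero_carrier_mat zero_carrier_mat assms])
      (use assms in auto)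
qed

theorem corollary3p3:
  fixes n s :: nat
    and A X :: "complex mat"
    and b :: "nat \<Rightarrow> complex vec"
    and bb :: "complex vec"
  assumes "n \<ge> 1" and "s \<ge> 1"
    and "A \<in> carrier_mat n n"
    and "\<And>i. i \<le> s \<Longrightarrow> b i \<in> carrier_vec n"
    and "b s \<noteq> 0\<^sub>v n"
    and "X \<in> carrier_mat (n * s) s"
    and "vec_space.rank (n * s) X = s"
    and "cols_form_basis (n * s) X (krylov s (J_mat n s) (b_bar n s b))"
    and "bb = Q_mat n s X *\<^sub>v c_vec n s b X"
  shows "mat_exp (W_mat n s A) *\<^sub>v bb
           = Q_mat n s X *\<^sub>v (mat_exp (K_mat n s A X) *\<^sub>v c_vec n s b X) \<and>
         Pi_W n s *\<^sub>v (mat_exp (W_mat n s A) *\<^sub>v bb)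
           = Pi_K n s *\<^sub>v (mat_exp (K_mat n s A X) *\<^sub>v c_vec n s b X) \<and>
         (\<forall>p :: complex poly.
           Pi_K n s *\<^sub>v ((mat_exp (K_mat n s A X) - mat_poly p (K_mat n s A X)) *\<^sub>v c_vec n s b X)
             = Pi_W n s *\<^sub>v ((mat_exp (W_mat n s A) - mat_poly p (W_mat n s A)) *\<^sub>v bb))"
proof -
  let ?W = "W_mat n s A" and ?Q = "Q_mat n s X" and ?K = "K_mat n s A X"
    and ?c = "c_vec n s b X" and ?J = "J_mat n s" and ?v = "b_bar n s b"
  have A: "A \<in> carrier_mat n n" and X: "X \<in> carrier_mat (n * s) s" using assms by auto
  have v: "?v \<in> carrier_vec (n * s)" by (simp add: b_bar_def)
  note D = cols_form_basisD[OF X J_mat_carrier v assms(8)]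
  \<comment> \<open>Unique existence is what allows the definite description \<open>N_mat\<close> to
    be unfolded.\<close>
  have "\<exists>!N. N \<in> carrier_mat s s \<and> ?J * X = X * N"
  proof (rule intertwining_matrix_ex1[OF X J_mat_carrier D(2)])
    fix x :: "complex vec" assume "x \<in> carrier_vec s"
    then show "?J *\<^sub>v (X *\<^sub>v x) \<in> (\<lambda>x. X *\<^sub>v x) ` carrier_vec s"
      using krylov_invariant[OF J_mat_carrier v J_mat_pow_eq_0] D(1) by blast
  qed
  then have N: "N_mat n s X \<in> carrier_mat s s" "?J * X = X * N_mat n s X"
    unfolding N_mat_def by (metis (mono_tags, lifting) theI')+
  have "?v \<in> krylov s ?J ?v"
  proof -
    interpret vec_space "TYPE(complex)" "n * s" .
    have sub: "(\<lambda>j. (?J ^\<^sub>m j) *\<^sub>v ?v) ` {..<s} \<subseteq> carrier_vec (n * s)"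
      by (auto intro!: mult_mat_vec_carrier[of _ "n * s" "n * s"] v)
    \<comment> \<open>The generator with exponent 0, which is present because \<open>s\<close> is at
      least 1.\<close>
    have "?v = (?J ^\<^sub>m 0) *\<^sub>v ?v" using v J_mat_carrier[of n s] by simp
    then have "?v \<in> (\<lambda>j. (?J ^\<^sub>m j) *\<^sub>v ?v) ` {..<s}" using \<open>s \<ge> 1\<close> by (intro image_eqI[of _ _ 0]) auto
    then show ?thesis
      using in_own_span[of "(\<lambda>j. (?J ^\<^sub>m j) *\<^sub>v ?v) ` {..<s}"] sub v
      by (auto simp: krylov_def)
  qed
  then obtain g where "g \<in> carrier_vec s" "?v = X *\<^sub>v g"
    unfolding D(1) by blast
  then have "\<exists>!g. g \<in> carrier_vec s \<and> ?v = X *\<^sub>v g"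
    using inj_onD[OF D(2)] by metis
  then have g: "gamma_vec n s b X \<in> carrier_vec s"
    unfolding gamma_vec_def by (metis (mono_tags, lifting) theI')
  have c: "?c \<in> carrier_vec (n + s)"
    using g assms(4)[of 0] by (simp add: c_vec_def)
  have E: "E_mat n s \<in> carrier_mat n (n * s)" by (simp add: E_mat_def id_zero_def)
  have W: "?W \<in> carrier_mat (n + n * s) (n + n * s)" using A E by (simp add: W_mat_def)
  have K: "?K \<in> carrier_mat (n + s) (n + s)" using A E X N by (simp add: K_mat_def)
  have Q: "?Q \<in> carrier_mat (n + n * s) (n + s)" using X by (simp add: Q_mat_def)
  \<comment> \<open>Only the lower right block is not immediate: there J X must equal X N.\<close>
  have "?W * ?Q = four_block_mat A (E_mat n s * X) (0\<^sub>m (n * s) n) (?J * X)"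
    unfolding W_mat_def Q_mat_def
    by (subst mult_four_block_mat[OF A E zero_carrier_mat J_mat_carrier
          one_carrier_mat zero_carrier_mat zero_carrier_mat X]) (use A E X in auto)
  also have "\<dots> = ?Q * ?K"
    unfolding K_mat_def Q_mat_def
    by (subst mult_four_block_mat[OF one_carrier_mat zero_carrier_mat zero_carrier_mat X
          A mult_carrier_mat[OF E X] zero_carrier_mat N(1)]) (use A E X N in auto)
  finally have WQ: "?W * ?Q = ?Q * ?K" .
  have Pi: "Pi_W n s \<in> carrier_mat n (n + n * s)" by (simp add: Pi_W_def id_zero_def)
  have PiQ: "Pi_W n s * ?Q = Pi_K n s"
    unfolding Pi_W_def Pi_K_def Q_mat_def by (rule id_zero_mult_four_block[OF X])
  \<comment> \<open>Kept general in \<open>F\<close> and \<open>G\<close> to serve both the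
    exponentials and their differences with the polynomials.\<close>
  have transfer: "F *\<^sub>v (?Q *\<^sub>v ?c) = ?Q *\<^sub>v (G *\<^sub>v ?c)"
    if "F \<in> carrier_mat (n + n * s) (n + n * s)" "G \<in> carrier_mat (n + s) (n + s)"
      and "F * ?Q = ?Q * G" for F G
    using that Q c assoc_mult_mat_vec[of F _ _ ?Q _ ?c] assoc_mult_mat_vec[of ?Q _ _ G _ ?c] by simp
  have project: "Pi_W n s *\<^sub>v (?Q *\<^sub>v x) = Pi_K n s *\<^sub>v x" if "x \<in> carrier_vec (n + s)" for x
    using that Pi Q PiQ assoc_mult_mat_vec[of "Pi_W n s" _ _ ?Q _ x] by simp
  note eW = mat_exp_carrier[OF W] and eK = mat_exp_carrier[OF K]
    and pW = mat_poly_carrier[OF W] and pK = mat_poly_carrier[OF K]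
  have exp: "mat_exp ?W *\<^sub>v bb = ?Q *\<^sub>v (mat_exp ?K *\<^sub>v ?c)"
    unfolding assms(9) by (rule transfer[OF eW eK mat_exp_intertwine[OF W K Q WQ]])
  moreover have "Pi_W n s *\<^sub>v (mat_exp ?W *\<^sub>v bb) = Pi_K n s *\<^sub>v (mat_exp ?K *\<^sub>v ?c)"
    unfolding exp by (rule project) (use eK c in \<open>auto intro: mult_mat_vec_carrier\<close>)
  moreover have "Pi_K n s *\<^sub>v ((mat_exp ?K - mat_poly p ?K) *\<^sub>v ?c)
      = Pi_W n s *\<^sub>v ((mat_exp ?W - mat_poly p ?W) *\<^sub>v bb)" for p
  proof -
    have dW: "mat_exp ?W - mat_poly p ?W \<in> carrier_mat (n + n * s) (n + n * s)"
      and dK: "mat_exp ?K - mat_poly p ?K \<in> carrier_mat (n + s) (n + s)"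
      using pW pK by (auto intro: minus_carrier_mat)
    \<comment> \<open>Intertwining is linear, so it passes from the exponential and the polynomial
      to their difference.\<close>
    have "(mat_exp ?W - mat_poly p ?W) * ?Q = ?Q * (mat_exp ?K - mat_poly p ?K)"
      using minus_mult_distrib_mat[OF eW pW Q] mult_minus_distrib_mat[OF Q eK pK]
        mat_exp_intertwine[OF W K Q WQ] mat_poly_intertwine[OF W K Q WQ] by simp
    then have "(mat_exp ?W - mat_poly p ?W) *\<^sub>v bb = ?Q *\<^sub>v ((mat_exp ?K - mat_poly p ?K) *\<^sub>v ?c)"
      unfolding assms(9) by (rule transfer[OF dW dK])
    then show ?thesis
      using project[of "(mat_exp ?K - mat_poly p ?K) *\<^sub>v ?c"] dK c by (auto intro: mult_mat_vec_carrier)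
  qed
  ultimately show ?thesis by blast
qed

end
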